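(* Suppose $\Omega$ is a convex body in $\mathbb{R}^n$ containing a nondegenerate simplex $S$. Let $\Omega'$ and $S'$ be the images of $\Omega$ and $S$ under a nondegenerate affine transform of $\mathbb{R}^n$. Let $P:C(\Omega)\to\Pi_1(\mathbb{R}^n)$ and $P':C(\Omega')\to\Pi_1(\mathbb{R}^n)$ be the interpolation projectors with the nodes in the vertices of $S$ and $S'$ respectively. Then $\|P\|_\Omega=\|P'\|_{\Omega'}$.
   Context: A convex body is a compact convex set with nonempty interior. $C(\Omega)$ is the space of continuous functions $f:\Omega\to\mathbb{R}$ with norm $\|f\|_{C(\Omega)}=\max_{x\in\Omega}|f(x)|$. $\Pi_1(\mathbb{R}^n)$ is the set of polynomials in $n$ variables of degree $\le 1$. For a nondegenerate $n$-dimensional simplex with vertices $x^{(1)},\dots,x^{(n+1)}\in\Omega$, the interpolation projector $P:C(\Omega)\to\Pi_1(\mathbb{R}^n)$ with nodes in its vertices is defined by $Pf(x^{(j)})=f(x^{(j)})$, $j=1,\dots,n+1$. $\|P\|_\Omega$ denotes the norm of $P$ as an operator from $C(\Omega)$ to $C(\Omega)$. *)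

theory Defs
  imports "HOL-Analysis.Analysis"
begin

definition convex_body :: "(real ^ 'n) set \<Rightarrow> bool" where
  "convex_body K \<longleftrightarrow> compact K \<and> convex K \<and> interior K \<noteq> {}"

text \<open>
  An element of the space of continuous functions on K is represented by a total function that is
  continuous on K; the values outside K are irrelevant, since the norm below reads only values
  on K. On a nonempty compact K the supremum is attained, hence is the maximum.
\<close>

definition cspace :: "(real ^ 'n) set \<Rightarrow> ((real ^ 'n) \<Rightarrow> real) set" where
  "cspace K = {f. continuous_on K f}"

definition cnorm :: "(real ^ 'n) set \<Rightarrow> ((real ^ 'n) \<Rightarrow> real) \<Rightarrow> real" where
  "cnorm K f = (SUP x\<in>K. \<bar>f x\<bar>)"

definition poly_deg_le1 :: "((real ^ 'n) \<Rightarrow> real) set" where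
  "poly_deg_le1 = {p. \<exists>c a. p = (\<lambda>x. c + (\<Sum>i\<in>UNIV. a i * x $ i))}"

definition vertices :: "(real ^ 'n) set \<Rightarrow> (real ^ 'n) set" where
  "vertices S = {v. v extreme_point_of S}"

definition interpolation_projector ::
  "(real ^ 'n) set \<Rightarrow> (real ^ 'n) set \<Rightarrow> (((real ^ 'n) \<Rightarrow> real) \<Rightarrow> ((real ^ 'n) \<Rightarrow> real)) \<Rightarrow> bool" where
  "interpolation_projector K S P \<longleftrightarrow>
     (\<forall>f\<in>cspace K. P f \<in> poly_deg_le1 \<and> (\<forall>v\<in>vertices S. P f v = f v))"

definition projector_norm ::
  "(real ^ 'n) set \<Rightarrow> (((real ^ 'n) \<Rightarrow> real) \<Rightarrow> ((real ^ 'n) \<Rightarrow> real)) \<Rightarrow> real" where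
  "projector_norm K P = (SUP f\<in>{f \<in> cspace K. cnorm K f \<le> 1}. cnorm K (P f))"

text \<open>
  The interpolation projector for an n-dimensional simplex exists and is unique on the space of
  continuous functions, and the supremum defining its norm is over a set that is bounded above.
\<close>

lemma vertices_simplex:
  assumes "\<not> affine_dependent C"
  shows "vertices (convex hull C) = C"
  using extreme_point_of_convex_hull_affine_independent[OF assms] by (auto simp: vertices_def)

lemma ex_interpolant:
  fixes C :: "(real ^ 'n) set" and g :: "real ^ 'n \<Rightarrow> real"
  assumes "\<not> affine_dependent C"
  shows "\<exists>p\<in>poly_deg_le1. \<forall>v\<in>C. p v = g v"
proof (cases "C = {}")
  case True
  have "(\<lambda>x. 0 + (\<Sum>i\<in>UNIV. 0 * x $ i)) \<in> (poly_deg_le1 :: ((real ^ 'n) \<Rightarrow> real) set)"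
    unfolding poly_deg_le1_def by (rule CollectI, rule exI, rule exI, rule refl)
  then show ?thesis using True by blast
next
  case False
  then obtain a where a: "a \<in> C" by auto
  have ind: "independent ((\<lambda>x. -a + x) ` (C - {a}))"
    using assms affine_dependent_iff_dependent2[OF a] by simp
  obtain h :: "real ^ 'n \<Rightarrow> real" where h: "linear h"
    "\<And>y. y \<in> (\<lambda>x. -a + x) ` (C - {a}) \<Longrightarrow> h y = g (a + y) - g a"
    using linear_independent_extend[OF ind, of "\<lambda>y. g (a + y) - g a"] by blast
  define p where "p x = g a - h a + h x" for x
  have hx: "h x = (\<Sum>i\<in>UNIV. h (axis i 1) * x $ i)" for x
  proof -
    have "h x = h (\<Sum>i\<in>UNIV. x $ i *\<^sub>R axis i 1)"
      using basis_expansion[of x] by (simp add: scalar_mult_eq_scaleR)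
    also have "\<dots> = (\<Sum>i\<in>UNIV. h (axis i 1) * x $ i)"
      by (simp add: linear_sum[OF h(1)] linear_cmul[OF h(1)] mult.commute)
    finally show ?thesis .
  qed
  have "p = (\<lambda>x. (g a - h a) + (\<Sum>i\<in>UNIV. h (axis i 1) * x $ i))"
    unfolding p_def hx[symmetric] by simp
  then have 1: "p \<in> poly_deg_le1" unfolding poly_deg_le1_def mem_Collect_eq by (intro exI)
  have 2: "p v = g v" if "v \<in> C" for v
  proof (cases "v = a")
    case False
    then have "h (-a + v) = g (a + (-a + v)) - g a" using that h(2) by blast
    moreover have "h (-a + v) = h v - h a" using linear_diff[OF h(1), of v a] by simp
    ultimately show ?thesis by (simp add: p_def)
  qed (simp add: p_def)
  show ?thesis using 1 2 by blast
qed

lemma poly_deg_le1_affine: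
  assumes "p \<in> poly_deg_le1" "sum u C = 1"
  shows "p (\<Sum>v\<in>C. u v *\<^sub>R v) = (\<Sum>v\<in>C. u v * p v)"
proof -
  obtain c a where p: "p = (\<lambda>x. c + (\<Sum>i\<in>UNIV. a i * x $ i))"
    using assms(1) unfolding poly_deg_le1_def by blast
  have "(\<Sum>i\<in>UNIV. a i * (\<Sum>v\<in>C. u v *\<^sub>R v) $ i) = (\<Sum>v\<in>C. u v * (\<Sum>i\<in>UNIV. a i * v $ i))"
    by (simp add: sum_distrib_left mult.left_commute) (rule sum.swap)
  moreover have "(\<Sum>v\<in>C. u v * c) = c"
    using assms(2) by (simp flip: sum_distrib_right)
  ultimately show ?thesis
    unfolding p by (simp add: distrib_left sum.distrib)
qed

lemma interpolation_projector_exists: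
  assumes "n simplex S"
  shows "\<exists>P. interpolation_projector K S P"
proof -
  obtain C where C: "\<not> affine_dependent C" "S = convex hull C"
    using assms unfolding simplex_def by blast
  show ?thesis
    unfolding interpolation_projector_def C(2) vertices_simplex[OF C(1)]
    using ex_interpolant[OF C(1)] by metis
qed

lemma interpolation_projector_unique:
  fixes K S :: "(real ^ 'n) set"
  assumes S: "int CARD('n) simplex S"
    and P: "interpolation_projector K S P" and Q: "interpolation_projector K S Q"
    and f: "f \<in> cspace K"
  shows "P f = Q f"
proof
  fix x
  obtain C where C: "\<not> affine_dependent C" "S = convex hull C" "card C = Suc CARD('n)"
    using S unfolding simplex_def by (metis Suc_eq_plus1 of_nat_1 of_nat_add of_nat_eq_iff)
  have fin: "finite C" using C(3) card.infinite by fastforce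
  have "x \<in> affine hull C" using affine_independent_span_eq[OF C(1)] C(3) by simp
  then obtain u where u: "sum u C = 1" "x = (\<Sum>v\<in>C. u v *\<^sub>R v)"
    unfolding affine_hull_finite[OF fin] by auto
  have "P f \<in> poly_deg_le1" "Q f \<in> poly_deg_le1" "\<forall>v\<in>C. P f v = Q f v"
    using P Q f unfolding interpolation_projector_def C(2) vertices_simplex[OF C(1)] by auto
  then show "P f x = Q f x" unfolding u(2) by (simp add: poly_deg_le1_affine u(1))
qed

lemma continuous_on_poly_deg_le1: "p \<in> poly_deg_le1 \<Longrightarrow> continuous_on K p"
  unfolding poly_deg_le1_def by (auto intro!: continuous_intros)

lemma bdd_above_projector_norm:
  fixes K S :: "(real ^ 'n) set"
  assumes K: "convex_body K" and S: "int CARD('n) simplex S" and sub: "S \<subseteq> K"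
    and P: "interpolation_projector K S P"
  shows "bdd_above ((\<lambda>f. cnorm K (P f)) ` {f \<in> cspace K. cnorm K f \<le> 1})"
proof -
  obtain C where C: "\<not> affine_dependent C" "S = convex hull C" "card C = Suc CARD('n)"
    using S unfolding simplex_def by (metis Suc_eq_plus1 of_nat_1 of_nat_add of_nat_eq_iff)
  have fin: "finite C" using C(3) card.infinite by fastforce
  have sp: "affine hull C = UNIV" using affine_independent_span_eq[OF C(1)] C(3) by simp
  have CK: "C \<subseteq> K" using sub C(2) hull_subset[of C convex] by blast
  have Kne: "K \<noteq> {}" and cK: "compact K" using K by (auto simp: convex_body_def)
  have "\<forall>w. \<exists>p\<in>poly_deg_le1. \<forall>v\<in>C. p v = (if v = w then 1 else 0)"
    by (intro allI ex_interpolant[OF C(1)])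
  then obtain l where l: "\<And>w. l w \<in> poly_deg_le1"
    "\<And>w v. v \<in> C \<Longrightarrow> l w v = (if v = w then 1 else (0::real))" by metis
  have rep: "p x = (\<Sum>v\<in>C. l v x * p v)" if "p \<in> poly_deg_le1" for p x
  proof -
    have "x \<in> affine hull C" using sp by simp
    then obtain u where u: "sum u C = 1" "x = (\<Sum>v\<in>C. u v *\<^sub>R v)"
      unfolding affine_hull_finite[OF fin] by auto
    have "l w x = u w" if "w \<in> C" for w
      unfolding u(2) poly_deg_le1_affine[OF l(1) u(1)]
      using that fin by (simp add: l(2) if_distrib cong: if_cong)
    then show ?thesis using poly_deg_le1_affine[OF that u(1)] u(2) by simp
  qed
  have bd: "bdd_above ((\<lambda>x. \<bar>f x\<bar>) ` K)" if "continuous_on K f" for f :: "real ^ 'n \<Rightarrow> real"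
    using that cK by (intro bounded_imp_bdd_above compact_imp_bounded compact_continuous_image)
      (auto intro!: continuous_intros)
  have ll: "continuous_on K (l v)" for v using continuous_on_poly_deg_le1 l(1) by blast
  show ?thesis
  proof (rule bdd_aboveI2)
    fix f assume f: "f \<in> {f \<in> cspace K. cnorm K f \<le> 1}"
    have f1: "\<bar>f x\<bar> \<le> 1" if "x \<in> K" for x
      using f that cSUP_upper[OF that bd[of f]] by (auto simp: cspace_def cnorm_def)
    show "cnorm K (P f) \<le> (\<Sum>v\<in>C. cnorm K (l v))"
      unfolding cnorm_def
    proof (rule cSUP_least[OF Kne])
      fix x assume x: "x \<in> K"
      have "P f \<in> poly_deg_le1" "\<And>v. v \<in> C \<Longrightarrow> P f v = f v"
        using P f unfolding interpolation_projector_def C(2) vertices_simplex[OF C(1)] by auto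
      then have "P f x = (\<Sum>v\<in>C. l v x * f v)" using rep[of "P f" x] by simp
      also have "\<bar>\<dots>\<bar> \<le> (\<Sum>v\<in>C. \<bar>l v x * f v\<bar>)" by (rule sum_abs)
      also have "\<dots> \<le> (\<Sum>v\<in>C. SUP x\<in>K. \<bar>l v x\<bar>)"
      proof (rule sum_mono)
        fix v assume "v \<in> C"
        then have "\<bar>l v x * f v\<bar> \<le> \<bar>l v x\<bar>"
          using f1[of v] CK by (auto simp: abs_mult intro!: mult_left_le)
        also have "\<dots> \<le> (SUP x\<in>K. \<bar>l v x\<bar>)" using cSUP_upper[OF x bd[OF ll]] .
        finally show "\<bar>l v x * f v\<bar> \<le> (SUP x\<in>K. \<bar>l v x\<bar>)" .
      qed
      finally show "\<bar>P f x\<bar> \<le> (\<Sum>v\<in>C. SUP x\<in>K. \<bar>l v x\<bar>)" .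
    qed
  qed
qed

end

theory Submission
  imports Defs
begin

text \<open>
  The whole setting is carried along by composition with the affine bijection \<open>T\<close>. The map
  \<open>g \<mapsto> g \<circ> T\<close> is an isometric bijection from the continuous functions on \<open>T ` K\<close> onto those on
  \<open>K\<close>; it takes polynomials of degree at most 1 to polynomials of degree at most 1, because \<open>T\<close>
  is affine, and it respects the interpolation nodes, because \<open>T\<close> maps the vertices of \<open>S\<close> onto
  the vertices of \<open>T ` S\<close>. Conjugating an interpolation projector for \<open>(T ` K, T ` S)\<close> with it
  therefore yields an interpolation projector for \<open>(K, S)\<close>
  (\<open>interpolation_projector_conjugate\<close>). On continuous functions there is only one such projector
  (\<open>interpolation_projector_unique\<close>), so \<open>P\<close> and \<open>P'\<close> are conjugate by an isometry. The
  isometry also matches the two unit balls, so both norms are suprema of the same set of reals.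
\<close>

lemma cnorm_image: "cnorm (T ` K) g = cnorm K (g \<circ> T)"
  by (simp add: cnorm_def image_image)

lemma cspace_compose:
  assumes "continuous_on K T" "g \<in> cspace (T ` K)"
  shows "g \<circ> T \<in> cspace K"
  using assms unfolding cspace_def by (blast intro: continuous_on_compose)

lemma poly_deg_le1_iff_inner:
  "p \<in> poly_deg_le1 \<longleftrightarrow> (\<exists>c a. p = (\<lambda>x. c + a \<bullet> x))"
proof
  assume "p \<in> poly_deg_le1"
  then obtain c a where "p = (\<lambda>x. c + (\<Sum>i\<in>UNIV. a i * x $ i))"
    unfolding poly_deg_le1_def by blast
  then have "p = (\<lambda>x. c + (\<chi> i. a i) \<bullet> x)"
    by (simp add: inner_vec_def)
  then show "\<exists>c a. p = (\<lambda>x. c + a \<bullet> x)" by blast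
next
  assume "\<exists>c a. p = (\<lambda>x. c + a \<bullet> x)"
  then obtain c a where "p = (\<lambda>x. c + (\<Sum>i\<in>UNIV. a $ i * x $ i))"
    by (auto simp: inner_vec_def)
  then show "p \<in> poly_deg_le1"
    unfolding poly_deg_le1_def mem_Collect_eq by (intro exI)
qed

lemma poly_deg_le1_compose_affine:
  fixes A :: "real ^ 'n ^ 'n"
  assumes "p \<in> poly_deg_le1"
  shows "p \<circ> (\<lambda>x. A *v x + b) \<in> poly_deg_le1"
proof -
  obtain c a where "p = (\<lambda>x. c + a \<bullet> x)"
    using assms by (auto simp: poly_deg_le1_iff_inner)
  then have "p \<circ> (\<lambda>x. A *v x + b) = (\<lambda>x. (c + a \<bullet> b) + (a v* A) \<bullet> x)"
    by (simp add: fun_eq_iff inner_add_right dot_lmul_matrix)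
  then show ?thesis
    unfolding poly_deg_le1_iff_inner by (intro exI)
qed

lemma vertices_linear_image:
  assumes "linear h" "inj h"
  shows "vertices (h ` S) = h ` vertices S"
  by (auto simp: vertices_def extreme_point_of_def open_segment_linear_image[OF assms]
      inj_image_mem_iff[OF assms(2)] inj_eq[OF assms(2)])

lemma vertices_affine_image:
  fixes A :: "real ^ 'n ^ 'n"
  assumes "invertible A"
  shows "vertices ((\<lambda>x. A *v x + b) ` S) = (\<lambda>x. A *v x + b) ` vertices S"
proof -
  have inj: "inj ((*v) A)"
    using assms by (simp add: inj_matrix_vector_mult)
  have "(\<lambda>x. A *v x + b) ` X = (+) b ` (*v) A ` X" for X
    by (simp add: image_image add.commute)
  moreover have "vertices ((+) b ` X) = (+) b ` vertices X" for X
    by (simp add: vertices_def extreme_points_of_translation)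
  ultimately show ?thesis
    by (simp only: vertices_linear_image[OF matrix_vector_mul_linear inj])
qed

text \<open>
  A continuous \<open>f\<close> on \<open>K\<close> is transported to the continuous function \<open>f \<circ> T'\<close> on \<open>T ` K\<close>, and
  its interpolant is pulled back along \<open>T\<close>, which keeps the degree at most 1 since \<open>T\<close> is
  affine. The result still interpolates \<open>f\<close>: its value at a vertex \<open>v\<close> of \<open>S\<close> is read off at the
  vertex \<open>T v\<close> of \<open>T ` S\<close>, where \<open>f \<circ> T'\<close> has the value \<open>f v\<close>.
\<close>

lemma interpolation_projector_conjugate:
  fixes A :: "real ^ 'n ^ 'n" and b :: "real ^ 'n"
  defines "T \<equiv> \<lambda>x. A *v x + b"
  assumes A: "invertible A"
    and T': "continuous_on (T ` K) T'" "\<And>x. T' (T x) = x"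
    and P': "interpolation_projector (T ` K) (T ` S) P'"
  shows "interpolation_projector K S (\<lambda>f. P' (f \<circ> T') \<circ> T)"
  unfolding interpolation_projector_def
proof (intro ballI conjI)
  fix f assume f: "f \<in> cspace K"
  have "T' ` T ` K = K"
    by (simp add: image_image T'(2))
  then have fT': "f \<circ> T' \<in> cspace (T ` K)"
    using cspace_compose[OF T'(1)] f by simp
  show "P' (f \<circ> T') \<circ> T \<in> poly_deg_le1"
    using P' fT' unfolding T_def interpolation_projector_def
    by (blast intro: poly_deg_le1_compose_affine)
  fix v assume "v \<in> vertices S"
  then have "T v \<in> vertices (T ` S)"
    by (simp add: T_def vertices_affine_image[OF A])
  then show "(P' (f \<circ> T') \<circ> T) v = f v"
    using P' fT' by (simp add: interpolation_projector_def T'(2))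
qed

theorem theorem3:
  fixes \<Omega> S \<Omega>' S' :: "(real ^ 'n) set"
    and A :: "real ^ 'n ^ 'n" and b :: "real ^ 'n"
    and P P' :: "((real ^ 'n) \<Rightarrow> real) \<Rightarrow> ((real ^ 'n) \<Rightarrow> real)"
  assumes "convex_body \<Omega>"
    and "int CARD('n) simplex S"
    and "S \<subseteq> \<Omega>"
    and "invertible A"
    and "\<Omega>' = (\<lambda>x. A *v x + b) ` \<Omega>"
    and "S' = (\<lambda>x. A *v x + b) ` S"
    and "interpolation_projector \<Omega> S P"
    and "interpolation_projector \<Omega>' S' P'"
  shows "projector_norm \<Omega> P = projector_norm \<Omega>' P'"
proof -
  define T where "T = (\<lambda>x. A *v x + b)"
  obtain B where AB: "A ** B = mat 1" "B ** A = mat 1"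
    using assms(4) unfolding invertible_def by blast
  define T' where "T' = (\<lambda>y. B *v (y - b))"
  have T'T: "T' (T x) = x" and TT': "T (T' y) = y" for x y
    by (simp_all add: T_def T'_def matrix_vector_mul_assoc AB)
  have "continuous_on X (\<lambda>x. M *v (x + c))" for X and M :: "real ^ 'n ^ 'n" and c
    by (rule linear_continuous_on_compose[OF _ matrix_vector_mul_linear]) (intro continuous_intros)
  from continuous_on_add[OF this[of _ A 0] continuous_on_const[of _ b]] this[of _ B "- b"]
  have contT: "continuous_on X T" and contT': "continuous_on X T'" for X
    by (simp_all add: T_def T'_def)
  have \<Omega>': "\<Omega>' = T ` \<Omega>" and S': "S' = T ` S"
    using assms(5,6) by (simp_all add: T_def)
  have \<Omega>: "\<Omega> = T' ` \<Omega>'"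
    by (simp add: \<Omega>' image_image T'T)
  have "interpolation_projector \<Omega> S (\<lambda>f. P' (f \<circ> T') \<circ> T)"
    using assms(8) unfolding \<Omega>' S' T_def
    by (intro interpolation_projector_conjugate assms(4) contT') (simp_all add: T'T[unfolded T_def])
  then have PP': "P f = P' (f \<circ> T') \<circ> T" if "f \<in> cspace \<Omega>" for f
    using interpolation_projector_unique[OF assms(2,7) _ that] by blast
  let ?B = "{f \<in> cspace \<Omega>. cnorm \<Omega> f \<le> 1}" and ?B' = "{g \<in> cspace \<Omega>'. cnorm \<Omega>' g \<le> 1}"
  have "f \<circ> T' \<in> ?B'" if "f \<in> ?B" for f
    using that cspace_compose[OF contT', of f \<Omega>'] cnorm_image[of T' \<Omega>' f]
    unfolding \<Omega>[symmetric] by simp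
  moreover have "g \<circ> T \<in> ?B" if "g \<in> ?B'" for g
    using that cspace_compose[OF contT, of g \<Omega>] cnorm_image[of T \<Omega> g]
    unfolding \<Omega>'[symmetric] by simp
  moreover have "g = (g \<circ> T) \<circ> T'" for g :: "real ^ 'n \<Rightarrow> real"
    by (simp add: fun_eq_iff TT')
  ultimately have "?B' = (\<lambda>f. f \<circ> T') ` ?B"
    by blast
  then have "(\<lambda>g. cnorm \<Omega>' (P' g)) ` ?B' = (\<lambda>f. cnorm \<Omega>' (P' (f \<circ> T'))) ` ?B"
    by (simp only: image_image)
  also have "\<dots> = (\<lambda>f. cnorm \<Omega> (P f)) ` ?B"
    by (intro image_cong refl) (simp add: PP' \<Omega>' cnorm_image)
  finally show ?thesis
    by (simp add: projector_norm_def)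
qed

end
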